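(* Let $k=k(n)$ satisfy $1\ll k\ll\log n$ as $n\to\infty$. Let $\omega:=\max\{(\log k)^2,\,k/n^{1/(2k)}\}$, and let $R_{k,1}$ be the minimal integer with $|B_{k,1}(R_{k,1})|\ge n e^{\omega}$. Let $\mathfrak{M}_{k,1}:=k\,n^{1/k}/(2e)$, let $K$ be a sufficiently large constant and let $\xi:=1-e^{-K\omega/k}$. Then (for $n$ sufficiently large) $$R_{k,1}\le\bigl\lceil\mathfrak{M}_{k,1}(1+\xi)\bigr\rceil\qquad\text{and}\qquad\bigl|B_{k,1}\bigl(\mathfrak{M}_{k,1}(1-\xi)\bigr)\bigr|\ll n.$$
   Context: $B_{k,1}(R):=\{a\in\mathbb{Z}^k:\sum_{i=1}^k|a_i|\le R\}$ and $|B|$ is the number of elements of $B$. Asymptotic notation is as $n\to\infty$: $a\ll b$ means $a/b\to0$. Logarithms are natural. *)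

theory Defs
  imports Complex_Main "HOL-Library.FuncSet" "HOL-Library.Landau_Symbols"
begin

text \<open>
  A point of \<open>\<int>\<^sup>k\<close> is a function on \<open>{1..k}\<close> (extensional, so that distinct functions
  are distinct points). The radius is real, since balls of non-integral radius occur.
\<close>

definition ball1 :: "nat \<Rightarrow> real \<Rightarrow> (nat \<Rightarrow> int) set" where
  "ball1 k R = {a \<in> {1..k} \<rightarrow>\<^sub>E UNIV. real_of_int (\<Sum>i=1..k. \<bar>a i\<bar>) \<le> R}"

definition omega :: "nat \<Rightarrow> nat \<Rightarrow> real" where
  "omega k n = max ((ln (real k))\<^sup>2) (real k / real n powr (1 / (2 * real k)))"

text \<open>
  The least such integer exists whenever \<open>k \<ge> 1\<close> and \<open>n \<ge> 1\<close>: balls of negative radius are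
  empty, and the size of the balls tends to infinity with the radius.
\<close>

definition R1 :: "nat \<Rightarrow> nat \<Rightarrow> int" where
  "R1 k n = (LEAST R :: int. real (card (ball1 k (real_of_int R))) \<ge> real n * exp (omega k n))"

definition M1 :: "nat \<Rightarrow> nat \<Rightarrow> real" where
  "M1 k n = real k * real n powr (1 / real k) / (2 * exp 1)"

definition xi :: "real \<Rightarrow> nat \<Rightarrow> nat \<Rightarrow> real" where
  "xi K k n = 1 - exp (- K * omega k n / real k)"

end

theory Submission imports Defs "HOL-Real_Asymp.Real_Asymp" begin

text \<open>
  The \<open>\<ell>\<^sup>1\<close> ball of integral radius \<open>r\<close> satisfies
  \<open>2 ^ k * (r choose k) \<le> card (ball1 k r) \<le> 2 ^ k * (r + k choose k)\<close>: the lower bound counts the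
  points without zero coordinates, the upper bound counts each point at least once as a sign
  pattern together with a non-negative point. With Stirling-type bounds for \<open>k!\<close>, both bounds have
  the form \<open>(2 e (r \<pm> k) / k) ^ k\<close>, up to a factor \<open>e k\<close> in the lower bound
  (\<open>card_ball1_ge_power\<close>, \<open>card_ball1_le_power\<close>).

  Write \<open>T = n powr (1 / k)\<close>, so that \<open>T ^ k = n\<close> and \<open>2 e M1 / k = T\<close>. At radius
  \<open>M1 (1 \<pm> \<xi>)\<close> the bases of these powers are \<open>T (1 \<pm> \<xi> \<mp> 2 e / T)\<close>. As \<open>\<xi>\<close> is of order
  \<open>K \<omega> / k\<close>, it contributes a factor \<open>exp (c K \<omega>)\<close> to the lower bound, for a constant \<open>c > 0\<close>, and
  \<open>exp (- K \<omega>)\<close> to the upper bound. The losses are absorbed by \<open>\<omega>\<close>: the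
  shift by \<open>k\<close> costs \<open>exp (O (k / T))\<close>, where \<open>k / T\<close> is much smaller than
  \<open>k / T powr (1 / 2) \<le> \<omega>\<close>, and the factor \<open>e k\<close> is at most \<open>exp (2 \<omega>)\<close> because
  \<open>ln k \<le> (ln k)\<^sup>2 \<le> \<omega>\<close>. Hence \<open>K = 14\<close> already suffices. The quantitative statement is
  \<open>ball_bounds\<close>; the two hypotheses on the growth of \<open>k\<close> make its assumptions hold eventually.
\<close>

section \<open>Counting the points of a ball\<close>

lemma ball1_0: "r \<ge> 0 \<Longrightarrow> ball1 0 r = {\<lambda>_. undefined}"
  by (auto simp: ball1_def)

lemma ball1_of_int: "ball1 k (real_of_int R) = {a \<in> {1..k} \<rightarrow>\<^sub>E UNIV. (\<Sum>i=1..k. \<bar>a i\<bar>) \<le> R}"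
  unfolding ball1_def by (simp only: of_int_le_iff)

lemma ball1_of_nat: "ball1 k (real r) = {a \<in> {1..k} \<rightarrow>\<^sub>E UNIV. (\<Sum>i=1..k. \<bar>a i\<bar>) \<le> int r}"
  using ball1_of_int[of k "int r"] by simp

lemma ball1_floor: "R \<ge> 0 \<Longrightarrow> ball1 k R = ball1 k (real (nat \<lfloor>R\<rfloor>))"
  unfolding ball1_of_nat by (simp add: ball1_def le_floor_iff del: of_int_sum)

text \<open>
  Slicing by the last coordinate \<open>j\<close>, whose absolute value is taken off the radius of the slice.
\<close>

lemma ball1_Suc_bij:
  "bij_betw (\<lambda>(j, a). a(Suc k := j)) 
     (SIGMA j:{- int r..int r}. ball1 k (real (r - nat \<bar>j\<bar>))) (ball1 (Suc k) (real r))"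
proof -
  have ins: "{1..Suc k} = insert (Suc k) {1..k}" by auto
  have sum_upd: "(\<Sum>i=1..k. \<bar>(a(Suc k := j)) i\<bar>) = (\<Sum>i=1..k. \<bar>a i\<bar>)" 
    for a :: "nat \<Rightarrow> int" and j
    by (intro sum.cong) auto
  have inj: "inj_on (\<lambda>(j, a). a(Suc k := j)) (UNIV \<times> ({1..k} \<rightarrow>\<^sub>E (UNIV :: int set)))"
    using inj_combinator[of "Suc k" "{1..k}" "\<lambda>_. UNIV :: int set"] by simp
  show ?thesis
  proof (rule bij_betw_imageI)
    show "inj_on (\<lambda>(j, a). a(Suc k := j)) (SIGMA j:{- int r..int r}. ball1 k (real (r - nat \<bar>j\<bar>)))"
      by (rule inj_on_subset[OF inj]) (auto simp: ball1_def)
    show "(\<lambda>(j, a). a(Suc k := j)) ` (SIGMA j:{- int r..int r}. ball1 k (real (r - nat \<bar>j\<bar>)))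
            = ball1 (Suc k) (real r)" (is "?l = ?r")
    proof (intro equalityI subsetI)
      fix b assume "b \<in> ?l"
      then obtain j a where b: "b = a(Suc k := j)" and j: "\<bar>j\<bar> \<le> int r"
        and a: "a \<in> ball1 k (real (r - nat \<bar>j\<bar>))" by auto
      have "(\<Sum>i=1..k. \<bar>a i\<bar>) \<le> int r - \<bar>j\<bar>"
        using a j by (simp add: ball1_of_nat del: of_nat_diff) linarith
      moreover have "b \<in> {1..Suc k} \<rightarrow>\<^sub>E UNIV" 
        using a unfolding ins PiE_insert_eq b ball1_def by auto
      ultimately have "b \<in> {1..Suc k} \<rightarrow>\<^sub>E UNIV \<and> (\<Sum>i=1..Suc k. \<bar>b i\<bar>) \<le> int r"
        using sum_upd[of a j] by (simp add: b)
      thus "b \<in> ?r" unfolding ball1_of_nat by simp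
    next
      fix b assume "b \<in> ?r"
      hence b: "b \<in> {1..Suc k} \<rightarrow>\<^sub>E UNIV" and s: "(\<Sum>i=1..Suc k. \<bar>b i\<bar>) \<le> int r"
        unfolding ball1_of_nat by auto
      from b obtain j a where ba: "b = a(Suc k := j)" and a: "a \<in> {1..k} \<rightarrow>\<^sub>E UNIV"
        unfolding ins PiE_insert_eq by auto
      have s': "(\<Sum>i=1..k. \<bar>a i\<bar>) + \<bar>j\<bar> \<le> int r"
        using s sum_upd[of a j] by (simp add: ba)
      moreover have "(\<Sum>i=1..k. \<bar>a i\<bar>) \<ge> 0" by (intro sum_nonneg) auto
      ultimately have j: "\<bar>j\<bar> \<le> int r" by linarith
      have "a \<in> ball1 k (real (r - nat \<bar>j\<bar>))"
        using a s' j unfolding ball1_of_nat by simp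
      thus "b \<in> ?l" using j ba by (intro image_eqI[of _ _ "(j, a)"]) auto
    qed
  qed
qed

lemma finite_ball1: "finite (ball1 k (real r))"
proof (induction k arbitrary: r)
  case (Suc k)
  show ?case
    by (subst bij_betw_finite[OF ball1_Suc_bij, symmetric]) (auto intro: Suc)
qed (simp add: ball1_0)

lemma card_ball1_Suc:
  "card (ball1 (Suc k) (real r)) = 
     card (ball1 k (real r)) + 2 * (\<Sum>s<r. card (ball1 k (real s)))"
proof -
  let ?f = "\<lambda>j. card (ball1 k (real (r - nat \<bar>j\<bar>)))"
  have "card (ball1 (Suc k) (real r)) = (\<Sum>j\<in>{- int r..int r}. ?f j)"
    by (subst bij_betw_same_card[OF ball1_Suc_bij, symmetric], subst card_SigmaI)
       (auto intro: finite_ball1)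
  also have "{- int r..int r} = {0} \<union> ({1..int r} \<union> {- int r..-1})" by auto
  also have "(\<Sum>j\<in>\<dots>. ?f j) = ?f 0 + ((\<Sum>j\<in>{1..int r}. ?f j) + (\<Sum>j\<in>{- int r..-1}. ?f j))"
    by (subst sum.union_disjoint, auto)+
  also have "(\<Sum>j\<in>{1..int r}. ?f j) = (\<Sum>s<r. card (ball1 k (real s)))"
    by (rule sum.reindex_bij_witness[of _ "\<lambda>s. int (r - s)" "\<lambda>j. r - nat j"]) auto
  also have "(\<Sum>j\<in>{- int r..-1}. ?f j) = (\<Sum>s<r. card (ball1 k (real s)))"
    by (rule sum.reindex_bij_witness[of _ "\<lambda>s. - int (r - s)" "\<lambda>j. r - nat (-j)"]) auto
  finally show ?thesis by simp
qed

text \<open>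
  Both binomial bounds follow from the slicing recursion by hockey-stick summation. For the lower
  bound the slice \<open>j = 0\<close> is dropped, for the upper bound it is counted twice.
\<close>

lemma card_ball1_ge: "2 ^ k * (r choose k) \<le> card (ball1 k (real r))"
proof (induction k arbitrary: r)
  case (Suc k)
  have "(\<Sum>s<r. s choose k) = r choose Suc k"
    by (cases r) (simp_all add: sum_choose_upper lessThan_Suc_atMost del: sum.lessThan_Suc)
  hence "2 ^ Suc k * (r choose Suc k) = 2 * (\<Sum>s<r. 2 ^ k * (s choose k))"
    by (simp flip: sum_distrib_left)
  also have "\<dots> \<le> 2 * (\<Sum>s<r. card (ball1 k (real s)))"
    by (intro mult_left_mono sum_mono Suc) auto
  finally show ?case by (simp add: card_ball1_Suc)
qed (simp add: ball1_0)

lemma card_ball1_le: "card (ball1 k (real r)) \<le> 2 ^ k * ((r + k) choose k)"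
proof (induction k arbitrary: r)
  case (Suc k)
  have "card (ball1 (Suc k) (real r)) \<le> 2 * (\<Sum>s\<le>r. card (ball1 k (real s)))"
    by (simp add: card_ball1_Suc flip: lessThan_Suc_atMost)
  also have "\<dots> \<le> 2 * (\<Sum>s\<le>r. 2 ^ k * ((s + k) choose k))"
    by (intro mult_left_mono sum_mono Suc) auto
  also have "\<dots> = 2 ^ Suc k * (\<Sum>s\<le>r. (k + s) choose k)"
    by (simp add: add.commute flip: sum_distrib_left)
  also have "\<dots> = 2 ^ Suc k * ((r + Suc k) choose Suc k)"
    by (subst choose_rising_sum) (simp add: add.commute)
  finally show ?case .
qed (simp add: ball1_0)

section \<open>Factorials and binomial coefficients\<close>

text \<open>The single term of index \<open>k\<close> in the exponential series of \<open>k\<close> is at most \<open>exp k\<close>.\<close>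

lemma fact_ge_power: "(real k / exp 1) ^ k \<le> fact k"
proof -
  have s: "(\<lambda>i. real k ^ i / fact i) sums exp (real k)"
    using exp_converges[of "real k"] by (simp add: divide_inverse mult.commute)
  have "(\<Sum>i\<in>{k}. real k ^ i / fact i) \<le> exp (real k)"
    using s by (intro sum_le_suminf[THEN order_trans]) (auto simp: sums_iff)
  thus ?thesis
    by (simp add: field_simps power_divide exp_of_nat_mult[symmetric])
qed

text \<open>
  By induction: the step amounts to \<open>(1 - 1 / (k + 1)) ^ (k + 1) \<le> exp (- 1)\<close>.
\<close>

lemma fact_le_power:
  assumes "k > 0" 
  shows "fact k \<le> exp 1 * real k * (real k / exp 1) ^ k"
  using assms
proof (induction k rule: nat_induct_non_zero)
  case (Suc k)
  define c where "c = (1 - 1 / real (Suc k)) ^ Suc k"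
  have "c \<le> exp (- 1 / real (Suc k)) ^ Suc k"
    unfolding c_def using exp_ge_add_one_self[of "- 1 / real (Suc k)"] 
    by (intro power_mono) auto
  also have "\<dots> = exp (-1)" by (subst exp_of_nat_mult[symmetric]) (simp del: of_nat_Suc)
  finally have c: "c * exp 1 \<le> 1" by (simp add: exp_minus field_simps)
  have kc: "real k ^ Suc k = real (Suc k) ^ Suc k * c"
    unfolding c_def power_mult_distrib[symmetric] by (rule arg_cong) (simp add: field_simps)
  have "(fact (Suc k) :: real) \<le> real (Suc k) * (exp 1 * real k * (real k / exp 1) ^ k)"
    using Suc.IH by (simp add: mult_left_mono del: of_nat_Suc)
  also have "\<dots> = real (Suc k) * real k ^ Suc k * exp 1 / exp 1 ^ k"
    by (simp add: power_divide)
  also have "\<dots> = (c * exp 1) * (exp 1 * real (Suc k) * (real (Suc k) / exp 1) ^ Suc k)"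
    unfolding kc by (simp add: power_divide field_simps)
  also have "\<dots> \<le> 1 * (exp 1 * real (Suc k) * (real (Suc k) / exp 1) ^ Suc k)"
    by (intro mult_right_mono c) auto
  finally show ?case by simp
qed simp

lemma binomial_ge_diff_power:
  assumes "k \<le> r"
  shows "(real r - real k) ^ k / fact k \<le> real (r choose k)"
proof -
  have "(real r - real k) ^ k = (\<Prod>i<k. real r - real k)" by simp
  also have "\<dots> \<le> (\<Prod>i<k. real r - real i)"
    using assms by (intro prod_mono) auto
  also have "\<dots> = fact k * real (r choose k)"
    using gbinomial_mult_fact[of k "real r"] 
    by (simp add: binomial_gbinomial atLeast0LessThan)
  finally show ?thesis by (simp add: field_simps)
qed

lemma card_ball1_ge_power:
  assumes "k > 0" "k \<le> R" "R \<le> real r"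
  shows "(2 * exp 1 * (R - k) / k) ^ k / (exp 1 * k) \<le> card (ball1 k (real r))"
proof -
  have "(2 * exp 1 * (R - k) / k) ^ k / (exp 1 * k)
          = 2 ^ k * ((R - k) ^ k / (exp 1 * real k * (real k / exp 1) ^ k))"
    using assms by (simp only: power_divide power_mult_distrib) (simp add: field_simps)
  also have "\<dots> \<le> 2 ^ k * ((real r - real k) ^ k / fact k)"
    using assms fact_le_power[of k] by (intro mult_left_mono frac_le power_mono) auto
  also have "\<dots> \<le> 2 ^ k * real (r choose k)"
    using assms by (intro mult_left_mono binomial_ge_diff_power) auto
  also have "\<dots> = real (2 ^ k * (r choose k))" by simp
  also have "\<dots> \<le> card (ball1 k (real r))"
    using card_ball1_ge of_nat_le_iff by blast
  finally show ?thesis .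
qed

lemma card_ball1_le_power:
  assumes "k > 0" "R \<ge> 0"
  shows "card (ball1 k R) \<le> (2 * exp 1 * (R + k) / k) ^ k"
proof -
  define r where "r = nat \<lfloor>R\<rfloor>"
  have r: "real r \<le> R" using assms by (simp add: r_def)
  have "real (((r + k) choose k) * fact k) \<le> real ((r + k) ^ k)"
    by (subst of_nat_le_iff) (rule binomial_fact_pow)
  hence b: "real ((r + k) choose k) \<le> (real r + real k) ^ k / fact k"
    by (simp add: field_simps)
  have "real (card (ball1 k R)) \<le> real (2 ^ k * ((r + k) choose k))"
    unfolding ball1_floor[OF assms(2)] r_def[symmetric] using card_ball1_le of_nat_le_iff by blast
  also have "\<dots> \<le> 2 ^ k * ((real r + real k) ^ k / fact k)"
    using b by (simp del: times_divide_eq_right)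
  also have "\<dots> \<le> 2 ^ k * ((R + k) ^ k / (real k / exp 1) ^ k)"
    using assms r fact_ge_power[of k] by (intro mult_left_mono frac_le power_mono) auto
  also have "\<dots> = (2 * exp 1 * (R + k) / k) ^ k"
    using assms by (simp only: power_divide power_mult_distrib) (simp add: field_simps)
  finally show ?thesis .
qed

section \<open>The two radii\<close>

text \<open>
  A least element over the integers needs an argument: balls of negative radius are empty, so the
  minimum is attained among the natural numbers.
\<close>

lemma R1_le:
  assumes n: "n > 0" and c: "real n * exp (omega k n) \<le> card (ball1 k (real r))"
  shows "R1 k n \<le> int r"
proof -
  define m where "m = (LEAST s. real n * exp (omega k n) \<le> card (ball1 k (real s)))"
  have m: "real n * exp (omega k n) \<le> card (ball1 k (real m))"
    unfolding m_def using c by (rule LeastI)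
  have mr: "m \<le> r" unfolding m_def using c by (rule Least_le)
  have "R1 k n = int m" unfolding R1_def
  proof (rule Least_equality)
    show "real n * exp (omega k n) \<le> card (ball1 k (real_of_int (int m)))" using m by simp
    fix R :: int assume R: "real n * exp (omega k n) \<le> card (ball1 k (real_of_int R))"
    have "ball1 k (real_of_int R) = {}" if "R < 0"
    proof -
      have "0 \<le> (\<Sum>i=1..k. \<bar>a i\<bar>)" for a :: "nat \<Rightarrow> int" by (intro sum_nonneg) auto
      hence "\<not> (\<Sum>i=1..k. \<bar>a i\<bar>) \<le> R" for a :: "nat \<Rightarrow> int"
        using that by (meson le_less_trans not_le)
      thus ?thesis unfolding ball1_of_int by simp
    qed
    hence "R \<ge> 0" using R n by (cases "R < 0") (auto simp: mult_le_0_iff)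
    hence "m \<le> nat R" unfolding m_def using R by (intro Least_le) simp
    thus "int m \<le> R" using \<open>R \<ge> 0\<close> by linarith
  qed
  thus ?thesis using mr by simp
qed

text \<open>
  The assumption \<open>K \<omega> \<le> k\<close> makes \<open>\<xi>\<close> comparable to \<open>K \<omega> / k\<close>, and \<open>18 k \<le> \<omega> T\<close> says that \<open>\<omega>\<close>
  dominates the cost \<open>k / T\<close> of shifting the radius by \<open>k\<close>. The constant 18 covers
  \<open>exp x * 2 * exp 1\<close> for \<open>x \<le> 1\<close>, in the upper bound. In the lower bound, a gain of
  \<open>exp (3 \<omega>)\<close> is required: one \<open>\<omega>\<close> from the definition of the radius and two from \<open>e k\<close>.
  Linearising the exponential doubles this to \<open>6 \<omega> / k\<close>, and \<open>\<xi> \<ge> K \<omega> / (2 k) \<ge> 7 \<omega> / k\<close> leaves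
  one \<open>\<omega> / k\<close> for the shift.
\<close>

lemma ball_bounds:
  fixes k n :: nat and K :: real
  defines "w \<equiv> omega k n" and "T \<equiv> real n powr (1 / real k)"
  assumes n: "n > 0" and k: "k > 0" and K: "14 \<le> K" and w: "1 \<le> w" "ln k \<le> w"
    and Kw: "K * w \<le> k" and T: "18 * real k \<le> w * T"
  shows R1_le_M1: "R1 k n \<le> \<lceil>M1 k n * (1 + xi K k n)\<rceil>"
    and card_ball1_M1: "card (ball1 k (M1 k n * (1 - xi K k n))) \<le> real n * exp (- w)"
proof -
  have T0: "T > 0" using n by (simp add: T_def)
  have Tk: "T ^ k = real n" using n k by (simp add: T_def powr_powr flip: powr_realpow)
  have M: "M1 k n = k * T / (2 * exp 1)" by (simp add: M1_def T_def)
  have e: "exp 1 \<le> (3 :: real)" by (rule exp_le)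
  define x where "x = K * w / k"
  have x: "0 \<le> x" "x \<le> 1" using K w Kw k by (auto simp: x_def)
  have xi: "xi K k n = 1 - exp (- x)" by (simp add: xi_def x_def w_def)
  have wk: "14 * (w / k) \<le> x" using K w k by (simp add: x_def divide_simps)
  have Tinv: "3 * (6 / T) \<le> w / k" using T T0 k by (simp add: field_simps)
  have eT: "2 * exp 1 / T \<le> 6 / T" using e T0 by (intro divide_right_mono) auto

  have "exp (- x) \<le> 1 - x / 2"
  proof -
    have "1 \<le> (1 - x / 2) * (1 + x)" 
      using mult_left_le[of x x] x by (simp add: algebra_simps)
    also have "\<dots> \<le> (1 - x / 2) * exp x"
      using x by (intro mult_left_mono exp_ge_add_one_self) auto
    finally show ?thesis by (simp add: exp_minus field_simps)
  qed
  hence xi_ge: "xi K k n \<ge> x / 2" by (simp add: xi)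
  have base: "exp (3 * (w / k)) \<le> 1 + xi K k n - 2 * exp 1 / T"
  proof -
    define y where "y = 3 * (w / k)"
    have y: "0 \<le> y" "y \<le> 1" using wk x w by (auto simp: y_def)
    have "exp y \<le> 1 + y + y\<^sup>2" using y by (intro exp_bound) auto
    also have "y\<^sup>2 \<le> y" using y by (simp add: power2_eq_square mult_left_le)
    finally have "exp y \<le> 1 + 2 * y" by simp
    also have "\<dots> \<le> 1 + xi K k n - 2 * exp 1 / T"
      using xi_ge wk Tinv eT y unfolding y_def by linarith
    finally show ?thesis by (simp add: y_def)
  qed

  define R where "R = M1 k n * (1 + xi K k n)"
  define r where "r = nat \<lceil>R\<rceil>"
  have R_eq: "2 * exp 1 * (R - k) / k = T * (1 + xi K k n - 2 * exp 1 / T)"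
    using k T0 by (simp add: R_def M field_simps)
  have "0 < T * (1 + xi K k n - 2 * exp 1 / T)"
    using T0 base by (smt (verit) exp_gt_zero mult_pos_pos)
  hence kR: "k \<le> R" using k unfolding R_eq[symmetric] 
    by (simp add: zero_less_divide_iff zero_less_mult_iff)
  have rR: "R \<le> real r" unfolding r_def by (rule of_nat_ceiling)
  have "real n * exp w * (exp 1 * k) = real n * exp (w + 1 + ln k)"
    using k by (simp add: exp_add)
  also have "\<dots> \<le> real n * exp (real k * (3 * (w / k)))"
    using w k by (intro mult_left_mono) auto
  also have "\<dots> = (T * exp (3 * (w / k))) ^ k"
    by (simp only: power_mult_distrib Tk exp_of_nat_mult)
  also have "\<dots> \<le> (2 * exp 1 * (R - k) / k) ^ k"
    unfolding R_eq using base T0 by (intro power_mono mult_left_mono) auto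
  finally have "real n * exp w \<le> (2 * exp 1 * (R - k) / k) ^ k / (exp 1 * k)"
    using k by (simp add: field_simps)
  also have "\<dots> \<le> card (ball1 k (real r))"
    using k kR rR by (intro card_ball1_ge_power)
  finally have "R1 k n \<le> int r" unfolding w_def by (rule R1_le[OF n])
  also have "int r = \<lceil>R\<rceil>" using kR k by (simp add: r_def)
  finally show "R1 k n \<le> \<lceil>M1 k n * (1 + xi K k n)\<rceil>" by (simp add: R_def)

  define S where "S = M1 k n * (1 - xi K k n)"
  have S: "S \<ge> 0" by (simp add: S_def xi M T0 less_imp_le)
  have "exp x \<le> 3" using x e by (meson exp_le_cancel_iff order_trans)
  hence ex: "exp x * (2 * exp 1 / T) \<le> 3 * (6 / T)"
    using eT T0 by (intro mult_mono) auto
  have "2 * exp 1 * (S + k) / k = T * exp (-x) * (1 + exp x * (2 * exp 1 / T))"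
    using k T0 by (simp add: S_def xi M field_simps exp_minus)
  also have "\<dots> \<le> T * exp (-x) * (1 + w / k)"
    using ex Tinv T0 by (intro mult_left_mono) auto
  also have "\<dots> \<le> T * exp (-x) * exp (w / k)"
    using T0 by (intro mult_left_mono exp_ge_add_one_self) auto
  also have "\<dots> = T * exp (w / k - x)" by (simp add: exp_diff exp_minus field_simps)
  also have "\<dots> \<le> T * exp (- (w / k))"
  proof -
    have "0 \<le> w / k" using w by simp
    hence "w / k - x \<le> - (w / k)" using wk by linarith
    thus ?thesis using T0 by (intro mult_left_mono) auto
  qed
  finally have S_le: "2 * exp 1 * (S + k) / k \<le> T * exp (- (w / k))" .
  have "card (ball1 k S) \<le> (2 * exp 1 * (S + k) / k) ^ k"
    by (rule card_ball1_le_power[OF k S])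
  also have "\<dots> \<le> (T * exp (- (w / k))) ^ k"
    using S S_le by (intro power_mono) auto
  also have "\<dots> = real n * exp (- w)"
    using k by (simp add: power_mult_distrib Tk flip: exp_of_nat_mult)
  finally show "card (ball1 k (M1 k n * (1 - xi K k n))) \<le> real n * exp (- w)"
    by (simp add: S_def)
qed

section \<open>Asymptotics\<close>

lemma filterlim_ratio_at_top_if_smallo:
  fixes f g :: "nat \<Rightarrow> real"
  assumes "f \<in> o(g)" "\<forall>\<^sub>F n in sequentially. f n > 0" "\<forall>\<^sub>F n in sequentially. g n \<ge> 0"
  shows "filterlim (\<lambda>n. g n / f n) at_top sequentially"
proof (subst filterlim_at_top_gt[of _ _ 0], intro allI impI)
  fix C :: real assume C: "C > 0"
  have "\<forall>\<^sub>F n in sequentially. norm (f n) \<le> inverse C * norm (g n)"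
    using C by (intro landau_o.smallD[OF assms(1)]) auto
  with assms(2,3) show "\<forall>\<^sub>F n in sequentially. C \<le> g n / f n"
    by eventually_elim (use C in \<open>auto simp: field_simps\<close>)
qed

lemma omega_eq:
  "n > 0 \<Longrightarrow> omega k n = max ((ln (real k))\<^sup>2) (real k * exp (- (ln n / k) / 2))"
  by (simp add: omega_def powr_def exp_minus field_simps)

theorem lemmaE:
  "\<exists>K0 :: real. \<forall>K \<ge> K0. \<forall>k :: nat \<Rightarrow> nat.
     (\<lambda>_. 1 :: real) \<in> o(\<lambda>n. real (k n)) \<and> (\<lambda>n. real (k n)) \<in> o(\<lambda>n. ln (real n)) \<longrightarrow>
     (\<forall>\<^sub>F n in sequentially. R1 (k n) n \<le> \<lceil>M1 (k n) n * (1 + xi K (k n) n)\<rceil>) \<and>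
     (\<lambda>n. real (card (ball1 (k n) (M1 (k n) n * (1 - xi K (k n) n))))) \<in> o(\<lambda>n. real n)"
proof (rule exI[of _ 14], intro allI impI)
  fix K :: real and k :: "nat \<Rightarrow> nat"
  assume K: "14 \<le> K"
    and "(\<lambda>_. 1 :: real) \<in> o(\<lambda>n. real (k n)) \<and> (\<lambda>n. real (k n)) \<in> o(\<lambda>n. ln (real n))"
  hence k1: "(\<lambda>_. 1 :: real) \<in> o(\<lambda>n. real (k n))" 
    and k2: "(\<lambda>n. real (k n)) \<in> o(\<lambda>n. ln (real n))" by auto
  have k_lim: "filterlim (\<lambda>n. real (k n)) at_top sequentially"
    using filterlim_ratio_at_top_if_smallo[OF k1] by simp
  have k_pos: "\<forall>\<^sub>F n in sequentially. real (k n) > 0"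
    using k_lim unfolding filterlim_at_top_dense by blast
  have L_lim: "filterlim (\<lambda>n. ln (real n) / real (k n)) at_top sequentially"
    by (intro filterlim_ratio_at_top_if_smallo k2 k_pos eventually_mono[OF eventually_gt_at_top[of 0]]) 
       auto
  have "\<forall>\<^sub>F x :: real in at_top. ln x \<ge> 1 \<and> K * (ln x)\<^sup>2 \<le> x"
    by (intro eventually_conj) real_asymp+
  from eventually_compose_filterlim[OF this k_lim]
  have ev_k: "\<forall>\<^sub>F n in sequentially. ln (k n) \<ge> 1 \<and> K * (ln (k n))\<^sup>2 \<le> k n" .
  have "\<forall>\<^sub>F x :: real in at_top. 18 * exp (- x / 2) \<le> 1 \<and> K * exp (- x / 2) \<le> 1"
    by (intro eventually_conj) real_asymp+
  from eventually_compose_filterlim[OF this L_lim]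
  have ev_L: "\<forall>\<^sub>F n in sequentially. 18 * exp (- (ln n / k n) / 2) \<le> 1 \<and> 
                K * exp (- (ln n / k n) / 2) \<le> 1" .
  have ev: "\<forall>\<^sub>F n in sequentially. 
      R1 (k n) n \<le> \<lceil>M1 (k n) n * (1 + xi K (k n) n)\<rceil> \<and>
      card (ball1 (k n) (M1 (k n) n * (1 - xi K (k n) n))) \<le> real n * exp (- omega (k n) n) \<and>
      ln (k n) \<le> omega (k n) n"
    using ev_k ev_L k_pos eventually_gt_at_top[of 0]
  proof eventually_elim
    case (elim n)
    define w where "w = omega (k n) n"
    define E where "E = exp (- (ln n / k n) / 2)"
    have w: "w = max ((ln (k n))\<^sup>2) (k n * E)" 
      unfolding w_def E_def using elim by (intro omega_eq) auto
    have "ln (k n) * 1 \<le> ln (k n) * ln (k n)"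
      using elim by (intro mult_left_mono) auto
    hence lnw: "ln (k n) \<le> w" by (simp add: w power2_eq_square)
    have "K * w \<le> k n"
    proof -
      have "real (k n) * (K * E) \<le> real (k n) * 1" using elim unfolding E_def by (intro mult_left_mono) auto
      thus ?thesis using elim unfolding w by (auto simp: max_def mult_ac)
    qed
    moreover have "18 * real (k n) \<le> w * real n powr (1 / real (k n))"
    proof -
      define T where "T = real n powr (1 / real (k n))"
      have ET: "E * E * T = 1" using elim by (simp add: E_def T_def powr_def flip: exp_add)
      have T0: "T > 0" using elim by (simp add: T_def)
      have E0: "E > 0" by (simp add: E_def)
      have "18 * real (k n) = k n * E * T * (18 * E)" using ET by (simp add: algebra_simps)
      also have "\<dots> \<le> k n * E * T * 1" 
        using elim T0 unfolding E_def by (intro mult_left_mono) auto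
      also have "\<dots> \<le> w * T" using T0 by (simp add: w)
      finally show ?thesis by (simp add: T_def)
    qed
    ultimately show ?case using elim K lnw ball_bounds[of n "k n" K] unfolding w_def by auto
  qed
  have "filterlim (\<lambda>n. ln (real (k n))) at_top sequentially"
    by (rule filterlim_compose[OF ln_at_top k_lim])
  hence w_lim: "filterlim (\<lambda>n. omega (k n) n) at_top sequentially"
    by (rule filterlim_at_top_mono) (use ev in \<open>auto elim: eventually_mono\<close>)
  have "(\<lambda>n. real (card (ball1 (k n) (M1 (k n) n * (1 - xi K (k n) n))))) \<in> o(\<lambda>n. real n)"
  proof (rule landau_o.smallI)
    fix c :: real assume c: "c > 0"
    have "\<forall>\<^sub>F x :: real in at_top. exp (- x) \<le> c" using c by real_asymp
    from eventually_compose_filterlim[OF this w_lim] ev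
    show "\<forall>\<^sub>F n in sequentially. 
        norm (real (card (ball1 (k n) (M1 (k n) n * (1 - xi K (k n) n))))) \<le> c * norm (real n)"
    proof eventually_elim
      case (elim n)
      have "real n * exp (- omega (k n) n) \<le> real n * c" 
        using elim by (intro mult_left_mono) auto
      thus ?case using elim by (simp add: mult.commute)
    qed
  qed
  with ev show "(\<forall>\<^sub>F n in sequentially. R1 (k n) n \<le> \<lceil>M1 (k n) n * (1 + xi K (k n) n)\<rceil>) \<and>
     (\<lambda>n. real (card (ball1 (k n) (M1 (k n) n * (1 - xi K (k n) n))))) \<in> o(\<lambda>n. real n)"
    by (auto elim: eventually_mono)
qed

end
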